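(* Let $\beta>0$, $c\ge 0$, $\beta^k=\beta/\tau^k$ and $c^k=c(1-\tau^k)\beta^k$ for all $k\ge 0$, where $1/\tau^{k-1}=(1-\tau^k)/\tau^k$ for $k\ge 0$ and $\tau^{-1}\in(0,1)$. Let $x'\in\Omega$ and $\lambda\in\mathbb{R}^l$. Suppose that the sequences $\{\breve x^k\}$, $\{\widetilde u^k\}$, $\{v^k\}$ are generated by the following prediction-correction framework: for every $k\ge 0$, with given $\breve x^{k-1}$ and $v^k$, the points $\breve x^k$ and $\widetilde u^k=(\widetilde x^k,\widetilde\lambda^k)$ satisfy $\widetilde x^k=\frac{1}{\tau^k}\breve x^k-\frac{1-\tau^k}{\tau^k}\breve x^{k-1}$ and $$\frac{1}{\tau^k}[f(x)-f(\breve x^k)]-\frac{1}{\tau^{k-1}}[f(x)-f(\breve x^{k-1})]+(u-\widetilde u^k)^TF(\widetilde u^k)+c^k(A(x-\widetilde x^k))^T(A\breve x^{k-1}-b)\ge (v-\widetilde v^k)^TQ^k(v^k-\widetilde v^k)\quad\forall u,$$ and $v^{k+1}=v^k-M^k(v^k-\widetilde v^k)$. Suppose that for each $k$ there exists a matrix $H^k$ with $Q^k=H^kM^k$, and put $G^k:=(Q^k)^T+Q^k-(M^k)^TH^kM^k$. Suppose further that there are matrices $H_0^k\succeq 0$ and numbers $\varTheta^k\ge 0$ such that for all $k\ge 0$ $$\|v^{k+1}-v'\|^2_{H^k}-\|v^k-v'\|^2_{H^k}+\|v^k-\widetilde v^k\|^2_{G^k}\ \ge\ \|v^{k+1}-v'\|^2_{H_0^{k+1}}-\|v^k-v'\|^2_{H_0^k}+\varTheta^{k+1}-\varTheta^k$$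 and $\varTheta^{k+1}-\varTheta^k\ge c\,\tau^k\beta^k\|A\widetilde x^k-b\|^2$. Then $$f(\breve x^k)-f(x')-\lambda^T(A\breve x^k-b)\le O(1/k),$$ i.e. there is a constant $C$ independent of $k$ such that the left-hand side is at most $C/k$ for all $k\ge 1$.
   Context: Problem: minimize $f(x)$ subject to $Ax=b$, with $f:\mathbb{R}^n\to\mathbb{R}$ closed, proper, convex, $A\in\mathbb{R}^{l\times n}$, $b\in\mathbb{R}^l$; $\Omega=\{x:Ax=b\}$. It is considered in one of three forms: (P1) no further structure; (P2) $x=(x_1,x_2)$, $f(x)=f_1(x_1)+f_2(x_2)$, $Ax=A_1x_1+A_2x_2$; (P3) $x=(x_1,\dots,x_m)$, $m\ge2$, $f(x)=\sum_{i=1}^m f_i(x_i)$, $Ax=\sum_{i=1}^m A_ix_i$, all $f_i$ closed proper convex real-valued. For $x\in\mathbb{R}^n$, $\lambda\in\mathbb{R}^l$ put $u=(x,\lambda)$ and $F(u)=(-A^T\lambda,\ Ax-b)$. The vector $v$ associated with $u$ is $v=(x,\lambda)$ for (P1), $v=(x_2,\lambda)$ for (P2), and $v=(A_2x_2,\dots,A_mx_m,\lambda)$ for (P3). Likewise $\widetilde v^k$ is the vector associated with $\widetilde u^k$, and $v'$ is the vector associated with $u'=(x',\lambda)$. The $v^k$ are vectors in the same space as $v$ ($v^0$ and $\breve x^{-1}$ are given), and $Q^k,M^k,H^k,H_0^k$ are real square matrices of matching size; $Q^k$ need not be symmetric. $\|w\|_D^2:=w^TDw$, whether or not $D$ is positive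 semidefinite.
   Formalization: The matrices H^k are assumed symmetric; for non-symmetric H^k the claim fails (e.g. f(x)=x^2, A=0, b=0, c=0, all predicted and averaged points equal to 1, x'=0, with H^k chosen so that the descent inequality holds). *)

theory Defs
  imports "HOL-Analysis.Analysis"
begin

definition feasible_set :: "real^'n^'l \<Rightarrow> real^'l \<Rightarrow> (real^'n) set" where
  "feasible_set A b = {x. A *v x = b}"

definition KKT_map :: "real^'n^'l \<Rightarrow> real^'l \<Rightarrow> (real^'n) \<times> (real^'l) \<Rightarrow> (real^'n) \<times> (real^'l)" where
  "KKT_map A b u = (- (transpose A *v snd u), A *v fst u - b)"

text \<open>The squared weighted norm is only a notation: no definiteness of \<open>D\<close> is required.\<close>

definition wnorm2 :: "real^'d^'d \<Rightarrow> real^'d \<Rightarrow> real" where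
  "wnorm2 D w = w \<bullet> (D *v w)"

text \<open>Symmetry is not part of this notion, so both conventions for positive semidefinite
  matrices are covered when it is used as a hypothesis.\<close>

definition pos_semidef :: "real^'d^'d \<Rightarrow> bool" where
  "pos_semidef D \<longleftrightarrow> (\<forall>w. 0 \<le> w \<bullet> (D *v w))"

text \<open>For a function with values in \<open>real\<close> on a nonempty domain, properness is automatic;
  closedness means that the epigraph is closed.\<close>

definition closed_convex_fun :: "(real^'n) set \<Rightarrow> (real^'n \<Rightarrow> real) \<Rightarrow> bool" where
  "closed_convex_fun S f \<longleftrightarrow> convex_on S f \<and> closed (epigraph S f)"

text \<open>A splitting of \<open>x\<close> into blocks \<open>x_1, \<dots>, x_m\<close> of possibly different dimensions is given by a map
  \<open>blk\<close> sending every coordinate of \<open>x\<close> to the number of its block. The space of the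
  block \<open>x_i\<close> is identified with the coordinate subspace \<open>block_space blk i\<close>, that is,
  \<open>x_i\<close> is padded with zeros outside of its block. Accordingly only the columns of \<open>Ai i\<close>
  belonging to block \<open>i\<close> and the values of \<open>fi i\<close> on \<open>block_space blk i\<close> matter.\<close>

definition block :: "('n \<Rightarrow> nat) \<Rightarrow> nat \<Rightarrow> real^'n \<Rightarrow> real^'n" where
  "block blk i x = (\<chi> j. if blk j = i then x $ j else 0)"

definition block_space :: "('n \<Rightarrow> nat) \<Rightarrow> nat \<Rightarrow> (real^'n) set" where
  "block_space blk i = {x. \<forall>j. blk j \<noteq> i \<longrightarrow> x $ j = 0}"

definition separable ::
  "nat \<Rightarrow> ('n \<Rightarrow> nat) \<Rightarrow> (nat \<Rightarrow> real^'n \<Rightarrow> real) \<Rightarrow> (nat \<Rightarrow> real^'n^'l)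
    \<Rightarrow> (real^'n \<Rightarrow> real) \<Rightarrow> real^'n^'l \<Rightarrow> bool" where
  "separable m blk fi Ai f A \<longleftrightarrow>
     range blk = {1..m} \<and>
     (\<forall>i\<in>{1..m}. closed_convex_fun (block_space blk i) (fi i)) \<and>
     (\<forall>x. f x = (\<Sum>i=1..m. fi i (block blk i x))) \<and>
     (\<forall>x. A *v x = (\<Sum>i=1..m. Ai i *v block blk i x))"

text \<open>\<open>V\<close> maps \<open>u = (x, \<lambda>)\<close> to its associated vector \<open>v\<close>, a real vector with coordinates indexed
  by \<open>'d\<close>. In each form \<open>e\<close> numbers the coordinates of \<open>v\<close>: it is a bijection between \<open>'d\<close> and
  the set of labels of the scalar entries of \<open>(x, \<lambda>)\<close>, of \<open>(x_2, \<lambda>)\<close>, and of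
  \<open>(A_2 x_2, \<dots>, A_m x_m, \<lambda>)\<close>, respectively. So \<open>v\<close> is exactly that tuple,
  and \<open>CARD('d)\<close> is its length.\<close>

definition form_P1 :: "((real^'n) \<times> (real^'l) \<Rightarrow> real^'d) \<Rightarrow> bool" where
  "form_P1 V \<longleftrightarrow> (\<exists>e :: 'd \<Rightarrow> 'n + 'l.
     bij e \<and>
     (\<forall>x y. V (x, y) = (\<chi> s. case e s of Inl j \<Rightarrow> x $ j | Inr r \<Rightarrow> y $ r)))"

definition form_P2 ::
  "(real^'n \<Rightarrow> real) \<Rightarrow> real^'n^'l \<Rightarrow> ((real^'n) \<times> (real^'l) \<Rightarrow> real^'d) \<Rightarrow> bool" where
  "form_P2 f A V \<longleftrightarrow> (\<exists>blk fi Ai. \<exists>e :: 'd \<Rightarrow> 'n + 'l.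
     separable 2 blk fi Ai f A \<and>
     bij_betw e UNIV ({j. blk j = 2} <+> UNIV) \<and>
     (\<forall>x y. V (x, y) = (\<chi> s. case e s of Inl j \<Rightarrow> x $ j | Inr r \<Rightarrow> y $ r)))"

definition form_P3 ::
  "nat \<Rightarrow> (real^'n \<Rightarrow> real) \<Rightarrow> real^'n^'l \<Rightarrow> ((real^'n) \<times> (real^'l) \<Rightarrow> real^'d) \<Rightarrow> bool" where
  "form_P3 m f A V \<longleftrightarrow> (\<exists>blk fi Ai. \<exists>e :: 'd \<Rightarrow> (nat \<times> 'l) + 'l.
     separable m blk fi Ai f A \<and>
     bij_betw e UNIV (({2..m} \<times> UNIV) <+> UNIV) \<and>
     (\<forall>x y. V (x, y) =
        (\<chi> s. case e s of Inl (i, r) \<Rightarrow> (Ai i *v block blk i x) $ r | Inr r \<Rightarrow> y $ r)))"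

end

theory Submission
  imports Defs
begin

text \<open>Testing the prediction inequality at \<open>u' = (x', \<lambda>)\<close> makes everything telescope. Write
  \<open>x\<^sub>k\<close> for \<open>xb k\<close>, \<open>a\<^sub>k = 1/\<tau>\<^sup>k\<close>, \<open>g\<^sub>k = f(x\<^sub>k) - f(x') - \<lambda>\<^sup>T(A x\<^sub>k - b)\<close> and \<open>s\<^sub>k = a\<^sub>k (A x\<^sub>k - b)\<close>.
  Since \<open>a\<^sub>k = a\<^sub>k\<^sub>-\<^sub>1 + 1\<close>, the predicted residual is \<open>s\<^sub>k - s\<^sub>k\<^sub>-\<^sub>1\<close>. The energy
  \<open>2 a\<^sub>k g\<^sub>k + c \<beta> \<parallel>s\<^sub>k\<parallel>\<^sup>2\<close> plus the squared \<open>H\<^sub>0\<close>-distance of \<open>v\<^sup>k\<^sup>+\<^sup>1\<close> to \<open>v'\<close> does not increase: the only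
  term of the wrong sign, \<open>c \<beta> \<parallel>s\<^sub>k - s\<^sub>k\<^sub>-\<^sub>1\<parallel>\<^sup>2\<close>, is absorbed by the growth of \<open>\<Theta>\<close>. As \<open>a\<^sub>k > k\<close>,
  bounded energy gives the rate \<open>1/k\<close>.\<close>

lemma inner_vector_matrix:
  fixes B :: "real^'m^'n"
  shows "x \<bullet> (y v* B) = (B *v x) \<bullet> y"
  by (metis dot_lmul_matrix inner_commute)

text \<open>Split \<open>p - w\<close> as \<open>(v - w) - (v - p)\<close>. Symmetry of
  \<open>H\<close> merges the two cross terms of the expanded square, and \<open>G\<close> is chosen
  so that its quadratic form cancels the leftover square of \<open>M *v (v - w)\<close>.\<close>

lemma correction_step_identity:
  fixes H M Q G :: "real^'d^'d" and v w p :: "real^'d"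
  assumes "transpose H = H" and Q: "Q = H ** M"
    and G: "G = transpose Q + Q - transpose M ** H ** M"
  shows "2 * ((p - w) \<bullet> (Q *v (v - w)))
    = wnorm2 H (v - M *v (v - w) - p) - wnorm2 H (v - p) + wnorm2 G (v - w)"
proof -
  define d where "d = v - w"
  have H: "x \<bullet> (H *v y) = y \<bullet> (H *v x)" for x y
    by (metis assms(1) inner_commute inner_vector_matrix transpose_matrix_vector)
  have G': "wnorm2 G d = 2 * (d \<bullet> (H *v (M *v d))) - (M *v d) \<bullet> (H *v (M *v d))"
    by (simp add: wnorm2_def G Q matrix_vector_mult_diff_rdistrib matrix_vector_mult_add_rdistrib
        inner_diff_right inner_add_right inner_commute inner_vector_matrix
        flip: matrix_vector_mul_assoc)
  have "wnorm2 H ((v - p) - M *v d) = wnorm2 H (v - p) - 2 * ((v - p) \<bullet> (H *v (M *v d)))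
      + (M *v d) \<bullet> (H *v (M *v d))"
    using H[of "M *v d" "v - p"]
    by (simp add: wnorm2_def matrix_vector_mult_diff_distrib inner_diff_left inner_diff_right)
  moreover have "(p - w) \<bullet> z = d \<bullet> z - (v - p) \<bullet> z" for z
    by (simp add: d_def inner_diff_left)
  moreover have "v - M *v d - p = (v - p) - M *v d"
    by simp
  ultimately show ?thesis
    unfolding d_def[symmetric] G' by (simp only: Q flip: matrix_vector_mul_assoc) simp
qed

text \<open>The linear part of \<open>KKT_map\<close> is skew-symmetric, so the terms quadratic in
  \<open>u\<close> cancel.\<close>

lemma KKT_map_inner_feasible:
  assumes "x' \<in> feasible_set A b"
  shows "((x', lam) - u) \<bullet> KKT_map A b u = lam \<bullet> (A *v fst u - b)"
proof -
  have "A *v x' = b"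
    using assms by (simp add: feasible_set_def)
  thus ?thesis
    by (cases u) (simp add: KKT_map_def inner_diff_left inner_diff_right
        inner_vector_matrix matrix_vector_mult_diff_distrib inner_commute algebra_simps)
qed

text \<open>The recursion excludes \<open>\<tau>\<^sup>k = 0\<close>, where division by zero would make its right-hand side \<open>0\<close>.\<close>

lemma inverse_step_sizes:
  fixes \<tau> :: "int \<Rightarrow> real"
  assumes tau: "\<forall>k\<ge>0. 1 / \<tau> (k - 1) = (1 - \<tau> k) / \<tau> k"
    and init: "0 < \<tau> (-1)"
  shows "1 / \<tau> (int n - 1) = real n + 1 / \<tau> (-1)"
proof (induction n)
  case (Suc n)
  have pos: "1 / \<tau> (int n - 1) > 0"
    unfolding Suc using init by (simp add: add_nonneg_pos)
  have "1 / \<tau> (int n - 1) = (1 - \<tau> (int n)) / \<tau> (int n)"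
    using tau by simp
  with pos have "1 / \<tau> (int n - 1) = 1 / \<tau> (int n) - 1"
    by (cases "\<tau> (int n) = 0") (simp_all add: diff_divide_distrib)
  with Suc show ?case by simp
qed simp

theorem lemma3p1:
  fixes f :: "real^'n \<Rightarrow> real" and A :: "real^'n^'l" and b :: "real^'l"
    and V :: "(real^'n) \<times> (real^'l) \<Rightarrow> real^'d"
    and \<beta> c :: real and \<tau> \<beta>s cs \<Theta> :: "int \<Rightarrow> real"
    and x' :: "real^'n" and lam :: "real^'l"
    and xb :: "int \<Rightarrow> real^'n" and ut :: "int \<Rightarrow> (real^'n) \<times> (real^'l)" and v :: "int \<Rightarrow> real^'d"
    and Q M H H0 G :: "int \<Rightarrow> real^'d^'d"
  assumes f: "closed_convex_fun UNIV f"
    and form: "form_P1 V \<or> form_P2 f A V \<or> (\<exists>m\<ge>2. form_P3 m f A V)"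
    and beta: "\<beta> > 0" and c: "c \<ge> 0"
    and betas: "\<forall>k\<ge>0. \<beta>s k = \<beta> / \<tau> k"
    and cs: "\<forall>k\<ge>0. cs k = c * (1 - \<tau> k) * \<beta>s k"
    and tau: "\<forall>k\<ge>0. 1 / \<tau> (k - 1) = (1 - \<tau> k) / \<tau> k"
    and tau_init: "0 < \<tau> (-1)" "\<tau> (-1) < 1"
    and x': "x' \<in> feasible_set A b"
    and xt: "\<forall>k\<ge>0. fst (ut k) = (1 / \<tau> k) *\<^sub>R xb k - ((1 - \<tau> k) / \<tau> k) *\<^sub>R xb (k - 1)"
    and prediction: "\<forall>k\<ge>0. \<forall>u.
        (1 / \<tau> k) * (f (fst u) - f (xb k)) - (1 / \<tau> (k - 1)) * (f (fst u) - f (xb (k - 1)))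
          + (u - ut k) \<bullet> KKT_map A b (ut k)
          + cs k * ((A *v (fst u - fst (ut k))) \<bullet> (A *v xb (k - 1) - b))
        \<ge> (V u - V (ut k)) \<bullet> (Q k *v (v k - V (ut k)))"
    and correction: "\<forall>k\<ge>0. v (k + 1) = v k - M k *v (v k - V (ut k))"
    and H_sym: "\<forall>k\<ge>0. transpose (H k) = H k"
    and QHM: "\<forall>k\<ge>0. Q k = H k ** M k"
    and G: "\<forall>k\<ge>0. G k = transpose (Q k) + Q k - transpose (M k) ** H k ** M k"
    and H0: "\<forall>k\<ge>0. pos_semidef (H0 k)"
    and Theta: "\<forall>k\<ge>0. \<Theta> k \<ge> 0"
    and descent: "\<forall>k\<ge>0.
        wnorm2 (H k) (v (k + 1) - V (x', lam)) - wnorm2 (H k) (v k - V (x', lam))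
          + wnorm2 (G k) (v k - V (ut k))
        \<ge> wnorm2 (H0 (k + 1)) (v (k + 1) - V (x', lam)) - wnorm2 (H0 k) (v k - V (x', lam))
          + \<Theta> (k + 1) - \<Theta> k"
    and Theta_growth: "\<forall>k\<ge>0. \<Theta> (k + 1) - \<Theta> k \<ge> c * \<tau> k * \<beta>s k * (norm (A *v fst (ut k) - b))\<^sup>2"
  shows "\<exists>C. \<forall>k\<ge>1. f (xb k) - f x' - lam \<bullet> (A *v xb k - b) \<le> C / real_of_int k"
proof -
  define p where "p = V (x', lam)"
  \<comment> \<open>Natural indices are shifted by one: \<open>n\<close> stands for iteration \<open>n - 1\<close>, so that \<open>n = 0\<close> is the
    initial point \<open>xb (-1)\<close>.\<close>
  define a where "a n = 1 / \<tau> (int n - 1)" for n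
  define r where "r n = A *v xb (int n - 1) - b" for n
  define g where "g n = f (xb (int n - 1)) - f x' - lam \<bullet> r n" for n
  define s where "s n = a n *\<^sub>R r n" for n
  define E where "E n = 2 * a n * g n + c * \<beta> * (norm (s n))\<^sup>2 + wnorm2 (H0 (int n)) (v (int n) - p)"
    for n
  have a: "a n = real n + 1 / \<tau> (-1)" for n
    unfolding a_def by (rule inverse_step_sizes[OF tau tau_init(1)])
  have a_gt: "a n > real n" for n
    using tau_init by (simp add: a)
  have Ax': "A *v x' = b"
    using x' by (simp add: feasible_set_def)
  have "E (Suc n) \<le> E n" for n
  proof -
    define k where "k = int n"
    have k: "k \<ge> 0" by (simp add: k_def)
    have a_Suc: "1 / \<tau> k = a (Suc n)" and a_n: "1 / \<tau> (k - 1) = a n"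
      by (simp_all add: a_def k_def)
    \<comment> \<open>A zero \<open>\<tau> k\<close> would give \<open>a (Suc n) = 0\<close> by the
      convention for division.\<close>
    have tau_nz: "\<tau> k \<noteq> 0"
      using a_gt[of "Suc n"] by (auto simp: a_def k_def)
    have ratio: "(1 - \<tau> k) / \<tau> k = a n"
      using tau k a_n by simp
    have res: "A *v fst (ut k) - b = s (Suc n) - s n"
    proof -
      have "fst (ut k) = a (Suc n) *\<^sub>R xb k - a n *\<^sub>R xb (k - 1)"
        using xt k ratio a_Suc by simp
      moreover have "a (Suc n) *\<^sub>R b = a n *\<^sub>R b + b"
        by (simp add: a scaleR_add_left)
      ultimately show ?thesis
        unfolding s_def r_def
        by (simp add: k_def matrix_vector_mult_diff_distrib matrix_vector_mult_scaleR
            scaleR_diff_right)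
    qed
    \<comment> \<open>The factor \<open>a n\<close> in \<open>cs k\<close> is exactly the weight
      that turns the previous residual into \<open>s n\<close>.\<close>
    have "cs k = c * \<beta> * a n"
      using cs betas k by (simp flip: ratio)
    moreover have "A *v (x' - fst (ut k)) = - (s (Suc n) - s n)"
      by (simp add: matrix_vector_mult_diff_distrib Ax' flip: res)
    moreover have "s n = a n *\<^sub>R (A *v xb (k - 1) - b)"
      by (simp add: s_def r_def k_def)
    ultimately have coupling: "cs k * ((A *v (x' - fst (ut k))) \<bullet> (A *v xb (k - 1) - b))
        = - (c * \<beta> * ((s (Suc n) - s n) \<bullet> s n))"
      by (simp only: inner_minus_left inner_scaleR_right)
    \<comment> \<open>Polarization makes the coupling term telescope, up to the square of the
      increment.\<close>
    have polar: "2 * ((s (Suc n) - s n) \<bullet> s n)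
        = (norm (s (Suc n)))\<^sup>2 - (norm (s n))\<^sup>2 - (norm (s (Suc n) - s n))\<^sup>2"
      by (simp add: power2_norm_eq_inner inner_diff_left inner_diff_right inner_commute)
    have kkt: "((x', lam) - ut k) \<bullet> KKT_map A b (ut k) = lam \<bullet> (s (Suc n) - s n)"
      by (simp add: KKT_map_inner_feasible[OF x'] res)
    have "(p - V (ut k)) \<bullet> (Q k *v (v k - V (ut k)))
        \<le> a (Suc n) * (f x' - f (xb k)) - a n * (f x' - f (xb (k - 1)))
          + lam \<bullet> (s (Suc n) - s n) - c * \<beta> * ((s (Suc n) - s n) \<bullet> s n)"
      using prediction[rule_format, OF k, of "(x', lam)"]
      unfolding kkt fst_conv coupling a_Suc a_n p_def by simp
    also have "\<dots> = a n * g n - a (Suc n) * g (Suc n) - c * \<beta> * ((s (Suc n) - s n) \<bullet> s n)"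
      by (simp add: g_def s_def k_def inner_diff_right algebra_simps)
    finally have pred: "2 * ((p - V (ut k)) \<bullet> (Q k *v (v k - V (ut k))))
        \<le> 2 * a n * g n - 2 * a (Suc n) * g (Suc n)
          - c * \<beta> * (2 * ((s (Suc n) - s n) \<bullet> s n))"
      by simp
    have "2 * ((p - V (ut k)) \<bullet> (Q k *v (v k - V (ut k))))
        = wnorm2 (H k) (v (k + 1) - p) - wnorm2 (H k) (v k - p) + wnorm2 (G k) (v k - V (ut k))"
      using correction_step_identity[of "H k" "Q k" "M k" "G k" p "V (ut k)" "v k"]
        H_sym QHM G correction k by simp
    also have "\<dots> \<ge> wnorm2 (H0 (k + 1)) (v (k + 1) - p) - wnorm2 (H0 k) (v k - p)
        + \<Theta> (k + 1) - \<Theta> k"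
      using descent k unfolding p_def by blast
    finally have dist: "wnorm2 (H0 (k + 1)) (v (k + 1) - p) - wnorm2 (H0 k) (v k - p)
        + \<Theta> (k + 1) - \<Theta> k \<le> 2 * ((p - V (ut k)) \<bullet> (Q k *v (v k - V (ut k))))" .
    have "c * \<tau> k * \<beta>s k = c * \<beta>"
      using betas k tau_nz by simp
    hence growth: "\<Theta> (k + 1) - \<Theta> k \<ge> c * \<beta> * (norm (s (Suc n) - s n))\<^sup>2"
      using Theta_growth k res by metis
    have "int (Suc n) = k + 1" "int n = k"
      by (simp_all add: k_def)
    thus ?thesis
      using pred dist growth unfolding polar E_def by (simp add: algebra_simps)
  qed
  hence E_le: "E n \<le> E 0" for n
    by (induction n) (auto intro: order_trans)
  \<comment> \<open>\<open>g n\<close> has no fixed sign, so \<open>E 0\<close> may be negative. The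
    maximum with \<open>0\<close> covers \<open>g n \<le> 0\<close>; only for positive
    \<open>g n\<close> can \<open>2 * a n\<close> be lowered to \<open>k\<close>.\<close>
  have "f (xb k) - f x' - lam \<bullet> (A *v xb k - b) \<le> max 0 (E 0) / real_of_int k" if "k \<ge> 1" for k
  proof -
    define n where "n = nat (k + 1)"
    have n: "int n - 1 = k" "real_of_int k \<le> real n" "real_of_int k > 0"
      using that by (simp_all add: n_def)
    have "0 \<le> c * \<beta> * (norm (s n))\<^sup>2"
      using c beta by simp
    moreover have "0 \<le> wnorm2 (H0 (int n)) (v (int n) - p)"
      using H0 by (simp add: pos_semidef_def wnorm2_def)
    ultimately have ag: "2 * a n * g n \<le> max 0 (E 0)"
      using E_le[of n] unfolding E_def by linarith
    have "g n \<le> max 0 (E 0) / real_of_int k"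
    proof (cases "g n \<le> 0")
      case False
      hence "real_of_int k * g n \<le> 2 * a n * g n"
        using a_gt[of n] n by (intro mult_right_mono) auto
      with ag n show ?thesis
        by (simp add: pos_le_divide_eq mult.commute)
    next
      case True
      also have "0 \<le> max 0 (E 0) / real_of_int k"
        using n by simp
      finally show ?thesis .
    qed
    thus ?thesis
      by (simp add: g_def r_def n)
  qed
  thus ?thesis by blast
qed

end
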